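(* Let $K$ be a finite simplicial complex with nonempty vertex set and $s\ge1$. Then for every integer $r\ge1$ the number of $(r,s)$-colorings of $K$ is \[ \chi^s(K,r)=\sum_{T\in L^s(K)}\mu(\emptyset,T)\,r^{|\pi(T)|}, \] where $\mu$ is the Möbius function of the poset $L^s(K)$.
   Context: An $s$-simplex of $K$ is a face with $s+1$ vertices; $F^s(K)$ is the set of them. An $(r,s)$-coloring is a map $V(K)\to\{1,\dots,r\}$ with no monochrome $s$-simplex, and $\chi^s(K,r)$ is their number. For $S\subseteq F^s(K)$: the connected components of $S$ are the equivalence classes of the smallest equivalence relation on $S$ relating simplices with nonempty intersection; $V(S)=\bigcup S$; $S$ is closed if $\{\sigma\in F^s(K)\mid\sigma\subseteq V(S)\}=S$; $\pi(S)$ is the partition of $V(K)$ whose blocks are the vertex sets of the connected components of $S$ together with the singletons $\{v\}$, $v\in V(K)\setminus V(S)$. $L^s(K)$ is the set of subsets of $F^s(K)$ all of whose connected components are closed, ordered by inclusion (a lattice with least element $\emptyset$). *)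

theory Defs
  imports Main "HOL-Library.FuncSet"
begin

text \<open>Abstract simplicial complexes, given by their set of faces. Only nonempty subsets of
  faces are required to be faces, so both conventions for the empty face are admitted; every
  element of \<open>\<Union>K\<close> is automatically a vertex (\<open>{v} \<in> K\<close>).\<close>

definition simplicial_complex :: "'a set set \<Rightarrow> bool" where
  "simplicial_complex K \<longleftrightarrow>
     (\<forall>\<sigma>\<in>K. finite \<sigma> \<and> (\<forall>\<tau>. \<tau> \<subseteq> \<sigma> \<and> \<tau> \<noteq> {} \<longrightarrow> \<tau> \<in> K))"

definition vertices :: "'a set set \<Rightarrow> 'a set" where
  "vertices K = \<Union>K"

definition simplices :: "nat \<Rightarrow> 'a set set \<Rightarrow> 'a set set" where
  "simplices s K = {\<sigma> \<in> K. card \<sigma> = s + 1}"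

definition monochrome :: "('a \<Rightarrow> nat) \<Rightarrow> 'a set \<Rightarrow> bool" where
  "monochrome f \<sigma> \<longleftrightarrow> (\<exists>c. \<forall>v\<in>\<sigma>. f v = c)"

text \<open>Colorings are taken as extensional functions on the vertex set, so that they can be counted.\<close>

definition colorings :: "nat \<Rightarrow> nat \<Rightarrow> 'a set set \<Rightarrow> ('a \<Rightarrow> nat) set" where
  "colorings r s K = {f \<in> vertices K \<rightarrow>\<^sub>E {1..r}. \<not> (\<exists>\<sigma>\<in>simplices s K. monochrome f \<sigma>)}"

definition num_colorings :: "nat \<Rightarrow> 'a set set \<Rightarrow> nat \<Rightarrow> nat" where
  "num_colorings s K r = card (colorings r s K)"

definition connectedness :: "'a set set \<Rightarrow> ('a set \<times> 'a set) set" where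
  "connectedness S = \<Inter>{R. equiv S R \<and> (\<forall>\<sigma>\<in>S. \<forall>\<tau>\<in>S. \<sigma> \<inter> \<tau> \<noteq> {} \<longrightarrow> (\<sigma>, \<tau>) \<in> R)}"

definition conn_components :: "'a set set \<Rightarrow> 'a set set set" where
  "conn_components S = S // connectedness S"

definition closed_simplices :: "nat \<Rightarrow> 'a set set \<Rightarrow> 'a set set \<Rightarrow> bool" where
  "closed_simplices s K S \<longleftrightarrow> {\<sigma> \<in> simplices s K. \<sigma> \<subseteq> vertices S} = S"

definition block_partition :: "'a set set \<Rightarrow> 'a set set \<Rightarrow> 'a set set" where
  "block_partition K S = vertices ` conn_components S \<union> {{v} |v. v \<in> vertices K - vertices S}"

definition chromatic_lattice :: "nat \<Rightarrow> 'a set set \<Rightarrow> 'a set set set" where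
  "chromatic_lattice s K =
     {S. S \<subseteq> simplices s K \<and> (\<forall>C\<in>conn_components S. closed_simplices s K C)}"

text \<open>The Moebius function of a locally finite poset \<open>P\<close> with the order of the ambient type,
  extended by \<open>0\<close>; for \<open>x < y\<close> the recursion says that \<open>mobius P x z\<close> sums to \<open>0\<close> over
  the interval from \<open>x\<close> to \<open>y\<close> in \<open>P\<close>.\<close>

function mobius :: "'b::order set \<Rightarrow> 'b \<Rightarrow> 'b \<Rightarrow> int" where
  "mobius P x y =
     (if x \<in> P \<and> y \<in> P \<and> x \<le> y \<and> finite {z \<in> P. x \<le> z \<and> z \<le> y}
      then if x = y then 1 else - (\<Sum>z \<in> {z \<in> P. x \<le> z \<and> z < y}. mobius P x z)
      else 0)"
  by pat_completeness auto

termination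
proof (relation "measure (\<lambda>(P, x, y). card {z \<in> P. x \<le> z \<and> z \<le> y})")
  show "wf (measure (\<lambda>(P, x, y). card {z \<in> P. x \<le> z \<and> z \<le> y}))"
    by simp
next
  fix P and x y z :: "'b::order"
  assume a: "x \<in> P \<and> y \<in> P \<and> x \<le> y \<and> finite {z \<in> P. x \<le> z \<and> z \<le> y}"
    and z: "z \<in> {z \<in> P. x \<le> z \<and> z < y}"
  have "{w \<in> P. x \<le> w \<and> w \<le> z} \<subseteq> {w \<in> P. x \<le> w \<and> w \<le> y}"
    using z by auto
  moreover have "y \<in> {w \<in> P. x \<le> w \<and> w \<le> y}" "y \<notin> {w \<in> P. x \<le> w \<and> w \<le> z}"
    using a z by auto
  ultimately have "{w \<in> P. x \<le> w \<and> w \<le> z} \<subset> {w \<in> P. x \<le> w \<and> w \<le> y}"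
    by blast
  then show "((P, x, z), (P, x, y)) \<in> measure (\<lambda>(P, x, y). card {z \<in> P. x \<le> z \<and> z \<le> y})"
    using a by (simp add: psubset_card_mono)
qed

declare mobius.simps [simp del]

end

theory Submission
  imports Defs "HOL-Library.Disjoint_Sets"
begin

text \<open>For a map \<open>f\<close> from the vertices to the colors, connected monochrome simplices share their
  color. So a simplex inside the vertex set of a component of the set \<open>M(f)\<close> of all monochrome
  simplices is itself monochrome, which puts \<open>M(f)\<close> into the lattice. Moebius inversion therefore
  expresses the number of \<open>f\<close> with \<open>M(f) = \<emptyset>\<close>, the colorings, through the numbers of \<open>f\<close> with
  \<open>T \<subseteq> M(f)\<close>; the latter \<open>f\<close> are the maps constant on the blocks of \<open>\<pi>(T)\<close>.\<close>

lemma mobius_eq_0_if_not_le: "\<not> x \<le> y \<Longrightarrow> mobius P x y = 0"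
  by (simp add: mobius.simps[of P x y])

lemma sum_mobius_interval:
  fixes x y :: "'a::order"
  assumes "x \<in> P" "y \<in> P" and finite_interval: "finite {z \<in> P. x \<le> z \<and> z \<le> y}"
  shows "(\<Sum>z | z \<in> P \<and> x \<le> z \<and> z \<le> y. mobius P x z) = of_bool (x = y)"
proof (cases "x \<le> y")
  case True
  let ?below = "{z \<in> P. x \<le> z \<and> z < y}"
  have interval_eq: "{z \<in> P. x \<le> z \<and> z \<le> y} = insert y ?below"
    using assms(2) True by auto
  then have "finite ?below"
    using finite_interval by simp
  then have "(\<Sum>z | z \<in> P \<and> x \<le> z \<and> z \<le> y. mobius P x z)
      = mobius P x y + (\<Sum>z\<in>?below. mobius P x z)"
    unfolding interval_eq by simp
  also have "\<dots> = of_bool (x = y)"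
  proof (cases "x = y")
    case True
    then have "(\<Sum>z\<in>?below. mobius P x z) = 0"
      by (intro sum.neutral) auto
    moreover have "mobius P x y = 1"
      using assms True by (subst mobius.simps) simp
    ultimately show ?thesis
      using True by simp
  next
    case False
    then show ?thesis
      using assms \<open>x \<le> y\<close> by (simp add: mobius.simps[of P x y])
  qed
  finally show ?thesis .
next
  case False
  then have empty_interval: "{z \<in> P. x \<le> z \<and> z \<le> y} = {}"
    using order_trans by blast
  show ?thesis
    unfolding empty_interval using False by auto
qed

lemma sum_mobius_lower:
  fixes x y :: "'a::order"
  assumes "finite P" "x \<in> P" "y \<in> P"
  shows "(\<Sum>z | z \<in> P \<and> z \<le> y. mobius P x z) = of_bool (x = y)"
proof -
  have "(\<Sum>z | z \<in> P \<and> z \<le> y. mobius P x z) = (\<Sum>z | z \<in> P \<and> x \<le> z \<and> z \<le> y. mobius P x z)"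
    using assms(1) by (intro sum.mono_neutral_right) (auto intro: mobius_eq_0_if_not_le)
  then show ?thesis
    using assms by (simp add: sum_mobius_interval)
qed

lemma mobius_inversion_upper:
  fixes g :: "'a::order \<Rightarrow> 'b::comm_ring_1"
  assumes "finite P" "x \<in> P"
  shows "(\<Sum>y\<in>P. of_int (mobius P x y) * (\<Sum>z | z \<in> P \<and> y \<le> z. g z)) = g x"
proof -
  have "(\<Sum>y\<in>P. of_int (mobius P x y) * (\<Sum>z | z \<in> P \<and> y \<le> z. g z))
      = (\<Sum>z\<in>P. \<Sum>y | y \<in> P \<and> y \<le> z. of_int (mobius P x y) * g z)"
    unfolding sum_distrib_left by (rule sum.swap_restrict[OF assms(1) assms(1)])
  also have "\<dots> = (\<Sum>z\<in>P. of_int (\<Sum>y | y \<in> P \<and> y \<le> z. mobius P x y) * g z)"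
    by (simp add: sum_distrib_right)
  also have "\<dots> = (\<Sum>z\<in>P. of_bool (x = z) * g z)"
    using assms by (intro sum.cong refl) (simp add: sum_mobius_lower)
  also have "\<dots> = (\<Sum>z\<in>{x}. g z)"
    using assms by (intro sum.mono_neutral_cong_right) auto
  finally show ?thesis
    by simp
qed

lemma card_fiber_eq_sum_mobius:
  fixes h :: "'a \<Rightarrow> 'b::order"
  assumes "finite A" "finite P" "h ` A \<subseteq> P" "x \<in> P"
  shows "int (card {a \<in> A. h a = x}) = (\<Sum>y\<in>P. mobius P x y * int (card {a \<in> A. y \<le> h a}))"
proof -
  have "card {a \<in> A. y \<le> h a} = (\<Sum>z | z \<in> P \<and> y \<le> z. card {a \<in> A. h a = z})" for y
  proof -
    have "card {a \<in> A. y \<le> h a} = (\<Sum>z | z \<in> P \<and> y \<le> z. card {a \<in> {a \<in> A. y \<le> h a}. h a = z})"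
      unfolding card_eq_sum using assms(1-3) by (intro sum.group[symmetric]) auto
    also have "\<dots> = (\<Sum>z | z \<in> P \<and> y \<le> z. card {a \<in> A. h a = z})"
      by (intro sum.cong refl arg_cong[of _ _ card]) auto
    finally show ?thesis .
  qed
  then show ?thesis
    using mobius_inversion_upper[OF assms(2,4), of "\<lambda>z. int (card {a \<in> A. h a = z})"] by simp
qed

lemma inj_on_compose_PiE_image: "inj_on (\<lambda>g. compose A g q) (q ` A \<rightarrow>\<^sub>E B)"
proof (rule inj_onI)
  fix g g' assume PiE: "g \<in> q ` A \<rightarrow>\<^sub>E B" "g' \<in> q ` A \<rightarrow>\<^sub>E B"
    and eq: "compose A g q = compose A g' q"
  have "g (q x) = g' (q x)" if "x \<in> A" for x
    using fun_cong[OF eq, of x] that by (simp add: compose_eq)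
  then show "g = g'"
    using PiE by (intro PiE_ext) auto
qed

lemma image_compose_PiE_eq_constant_on_fibers:
  "(\<lambda>g. compose A g q) ` (q ` A \<rightarrow>\<^sub>E B)
    = {f \<in> A \<rightarrow>\<^sub>E B. \<forall>x\<in>A. \<forall>y\<in>A. q x = q y \<longrightarrow> f x = f y}"
    (is "?comp ` _ = ?constant")
proof (intro equalityI subsetI)
  fix f assume "f \<in> ?constant"
  then have f: "f \<in> A \<rightarrow>\<^sub>E B" and fiberwise: "\<forall>x\<in>A. \<forall>y\<in>A. q x = q y \<longrightarrow> f x = f y"
    by blast+
  let ?g = "\<lambda>p\<in>q ` A. f (inv_into A q p)"
  have "f = ?comp ?g"
  proof (rule extensionalityI)
    fix x assume "x \<in> A"
    then have "inv_into A q (q x) \<in> A" "q (inv_into A q (q x)) = q x"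
      by (auto intro: inv_into_into f_inv_into_f)
    then have "f (inv_into A q (q x)) = f x"
      using fiberwise \<open>x \<in> A\<close> by blast
    then show "f x = ?comp ?g x"
      using \<open>x \<in> A\<close> by (simp add: compose_eq)
  qed (use f in \<open>simp_all add: PiE_def\<close>)
  moreover have "f (inv_into A q p) \<in> B" if "p \<in> q ` A" for p
    using f inv_into_into[OF that] by (rule PiE_mem)
  then have "?g \<in> q ` A \<rightarrow>\<^sub>E B"
    by simp
  ultimately show "f \<in> ?comp ` (q ` A \<rightarrow>\<^sub>E B)"
    by (rule image_eqI)
qed (auto simp: compose_def)

lemma card_PiE_respecting_equiv:
  assumes "finite A" "equiv A r"
  shows "card {f \<in> A \<rightarrow>\<^sub>E B. f respects r} = card B ^ card (A // r)"
proof -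
  have quotient_eq_image: "A // r = (\<lambda>x. r `` {x}) ` A"
    by (auto simp: quotient_def)
  have "f respects r \<longleftrightarrow> (\<forall>x\<in>A. \<forall>y\<in>A. r `` {x} = r `` {y} \<longrightarrow> f x = f y)" for f :: "'a \<Rightarrow> 'b"
    using eq_equiv_class_iff[OF assms(2)] equiv_type[OF assms(2)] unfolding congruent_def by blast
  then have "{f \<in> A \<rightarrow>\<^sub>E B. f respects r} = (\<lambda>g. compose A g (\<lambda>x. r `` {x})) ` (A // r \<rightarrow>\<^sub>E B)"
    unfolding quotient_eq_image image_compose_PiE_eq_constant_on_fibers by simp
  then have "card {f \<in> A \<rightarrow>\<^sub>E B. f respects r} = card (A // r \<rightarrow>\<^sub>E B)"
    by (simp add: quotient_eq_image card_image[OF inj_on_compose_PiE_image])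
  also have "\<dots> = card B ^ card (A // r)"
    using assms(1) by (simp add: quotient_eq_image card_funcsetE)
  finally show ?thesis .
qed

lemma partition_on_Un:
  assumes "partition_on A P" "partition_on B Q" "disjnt A B"
  shows "partition_on (A \<union> B) (P \<union> Q)"
  using assms by (auto simp: partition_on_def disjnt_def intro!: disjoint_union)

lemma monochrome_iff: "monochrome f \<sigma> \<longleftrightarrow> (\<forall>x\<in>\<sigma>. \<forall>y\<in>\<sigma>. f x = f y)"
  unfolding monochrome_def by metis

lemma monochrome_subset: "monochrome f \<tau> \<Longrightarrow> \<sigma> \<subseteq> \<tau> \<Longrightarrow> monochrome f \<sigma>"
  unfolding monochrome_def by blast

lemma card_PiE_monochrome_blocks:
  assumes "finite A" "partition_on A P"
  shows "card {f \<in> A \<rightarrow>\<^sub>E B. \<forall>p\<in>P. monochrome f p} = card B ^ card P"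
proof -
  let ?same_block = "{(x, y). \<exists>p\<in>P. x \<in> p \<and> y \<in> p}"
  have "(\<forall>p\<in>P. monochrome f p) \<longleftrightarrow> f respects ?same_block" for f
    by (auto simp: monochrome_iff congruent_def)
  then show ?thesis
    using card_PiE_respecting_equiv[OF assms(1) equiv_partition_on[OF assms(2)], of B]
    by (simp add: partition_on_eq_quotient[OF assms(2)])
qed

lemma equiv_connectedness: "equiv S (connectedness S)"
proof (rule equivI)
  have "equiv S (S \<times> S)"
    by (auto intro!: equivI refl_onI symI transI)
  then show "connectedness S \<subseteq> S \<times> S"
    unfolding connectedness_def by blast
  show "refl_on S (connectedness S)"
    by (auto simp: connectedness_def refl_on_def equiv_def)
  show "sym (connectedness S)"
    by (rule symI) (auto simp: connectedness_def equiv_def dest: symD)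
  show "trans (connectedness S)"
    by (rule transI) (auto simp: connectedness_def equiv_def dest: transD)
qed

lemma partition_on_conn_components: "partition_on S (conn_components S)"
  unfolding conn_components_def using equiv_connectedness by (rule partition_on_quotient)

lemma Union_conn_components: "\<Union>(conn_components S) = S"
  by (rule partition_onD1[OF partition_on_conn_components, symmetric])

lemma conn_component_subset: "C \<in> conn_components S \<Longrightarrow> C \<subseteq> S"
  using Union_conn_components by blast

lemma conn_component_memI:
  assumes "C \<in> conn_components S" "\<sigma> \<in> S" "\<sigma> \<inter> vertices C \<noteq> {}"
  shows "\<sigma> \<in> C"
proof -
  obtain \<tau> where \<tau>: "\<tau> \<in> C" "\<tau> \<inter> \<sigma> \<noteq> {}"
    using assms(3) unfolding vertices_def by blast
  then have "(\<tau>, \<sigma>) \<in> connectedness S"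
    using assms(1,2) conn_component_subset unfolding connectedness_def by blast
  then show ?thesis
    using in_quotient_imp_closed[OF equiv_connectedness] assms(1) \<tau>(1)
    unfolding conn_components_def by blast
qed

lemma conn_component_invariant:
  assumes "\<And>\<sigma> \<tau>. \<sigma> \<in> S \<Longrightarrow> \<tau> \<in> S \<Longrightarrow> \<sigma> \<inter> \<tau> \<noteq> {} \<Longrightarrow> g \<sigma> = g \<tau>"
    and C: "C \<in> conn_components S" "\<sigma> \<in> C" "\<tau> \<in> C"
  shows "g \<sigma> = g \<tau>"
proof -
  have "equiv S {(\<sigma>, \<tau>) \<in> S \<times> S. g \<sigma> = g \<tau>}"
    by (auto intro!: equivI refl_onI symI transI)
  then have "connectedness S \<subseteq> {(\<sigma>, \<tau>) \<in> S \<times> S. g \<sigma> = g \<tau>}"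
    unfolding connectedness_def using assms(1) by blast
  moreover have "(\<sigma>, \<tau>) \<in> connectedness S"
    using C in_quotient_imp_in_rel[OF equiv_connectedness] unfolding conn_components_def by blast
  ultimately show ?thesis
    by blast
qed

lemma disjnt_vertices_conn_components:
  assumes "C \<in> conn_components S" "D \<in> conn_components S" "disjnt C D"
  shows "disjnt (vertices C) (vertices D)"
proof (rule ccontr)
  assume "\<not> disjnt (vertices C) (vertices D)"
  then obtain \<sigma> where "\<sigma> \<in> D" "\<sigma> \<inter> vertices C \<noteq> {}"
    unfolding vertices_def disjnt_def by blast
  then have "\<sigma> \<in> C"
    using assms(1,2) conn_component_subset by (blast intro: conn_component_memI)
  with assms(3) \<open>\<sigma> \<in> D\<close> show False
    by (auto simp: disjnt_def)
qed

lemma partition_on_vertices_conn_components: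
  assumes "{} \<notin> S"
  shows "partition_on (vertices S) (vertices ` conn_components S)"
proof -
  have "partition_on (vertices S) (vertices ` conn_components S - {{}})"
  proof (rule partition_on_transform[OF partition_on_conn_components])
    show "\<Union>(vertices ` conn_components S) = vertices (\<Union>(conn_components S))"
      by (auto simp: vertices_def)
  qed (rule disjnt_vertices_conn_components)
  moreover have "{} \<noteq> vertices C" if "C \<in> conn_components S" for C
  proof -
    have "C \<noteq> {}"
      using that partition_onD3[OF partition_on_conn_components] by blast
    moreover have "{} \<notin> C"
      using that assms conn_component_subset by blast
    ultimately show ?thesis
      by (auto simp: vertices_def)
  qed
  then have "{} \<notin> vertices ` conn_components S"
    by blast
  ultimately show ?thesis
    by simp
qed

lemma partition_on_block_partition:
  assumes "S \<subseteq> K" "{} \<notin> S"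
  shows "partition_on (vertices K) (block_partition K S)"
proof -
  have "vertices K = vertices S \<union> (vertices K - vertices S)"
    using assms(1) by (auto simp: vertices_def)
  moreover have "block_partition K S
      = vertices ` conn_components S \<union> (\<lambda>v. {v}) ` (vertices K - vertices S)"
    by (auto simp: block_partition_def)
  ultimately show ?thesis
    using partition_on_Un[OF partition_on_vertices_conn_components[OF assms(2)]
        partition_on_singletons[of "vertices K - vertices S"]]
    by (simp add: disjnt_def)
qed

lemma monochrome_vertices_conn_component:
  assumes "\<forall>\<sigma>\<in>S. monochrome f \<sigma>" and C: "C \<in> conn_components S"
  shows "monochrome f (vertices C)"
  unfolding monochrome_iff
proof (intro ballI)
  fix x y assume "x \<in> vertices C" "y \<in> vertices C"
  then obtain \<sigma> \<tau> where \<sigma>: "\<sigma> \<in> C" "x \<in> \<sigma>" and \<tau>: "\<tau> \<in> C" "y \<in> \<tau>"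
    unfolding vertices_def by blast
  have "f ` \<sigma> = f ` \<tau>"
  proof (rule conn_component_invariant[OF _ C \<sigma>(1) \<tau>(1)])
    fix \<sigma> \<tau> assume "\<sigma> \<in> S" "\<tau> \<in> S" "\<sigma> \<inter> \<tau> \<noteq> {}"
    then obtain v where "v \<in> \<sigma>" "v \<in> \<tau>" "monochrome f \<sigma>" "monochrome f \<tau>"
      using assms(1) by blast
    then have "f ` \<sigma> = {f v}" "f ` \<tau> = {f v}"
      by (auto simp: monochrome_def)
    then show "f ` \<sigma> = f ` \<tau>"
      by simp
  qed
  then have "f x \<in> f ` \<tau>"
    using \<sigma>(2) by blast
  moreover have "monochrome f \<tau>"
    using assms(1) C \<tau>(1) conn_component_subset by blast
  ultimately show "f x = f y"
    using \<tau>(2) by (auto simp: monochrome_def)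
qed

lemma all_monochrome_iff_blocks_monochrome:
  "(\<forall>\<sigma>\<in>S. monochrome f \<sigma>) \<longleftrightarrow> (\<forall>p\<in>block_partition K S. monochrome f p)"
proof
  assume "\<forall>\<sigma>\<in>S. monochrome f \<sigma>"
  then have "monochrome f (vertices C)" if "C \<in> conn_components S" for C
    using that by (rule monochrome_vertices_conn_component)
  moreover have "monochrome f {v}" for v
    by (simp add: monochrome_def)
  ultimately show "\<forall>p\<in>block_partition K S. monochrome f p"
    unfolding block_partition_def by blast
next
  assume blocks: "\<forall>p\<in>block_partition K S. monochrome f p"
  show "\<forall>\<sigma>\<in>S. monochrome f \<sigma>"
  proof
    fix \<sigma> assume "\<sigma> \<in> S"
    then obtain C where C: "C \<in> conn_components S" "\<sigma> \<in> C"
      using Union_conn_components by blast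
    then have "monochrome f (vertices C)"
      using blocks by (simp add: block_partition_def)
    then show "monochrome f \<sigma>"
      using C(2) by (elim monochrome_subset) (auto simp: vertices_def)
  qed
qed

lemma empty_notin_simplices: "{} \<notin> simplices s K"
  by (simp add: simplices_def)

lemma closed_simplices_conn_component:
  assumes S: "S \<subseteq> simplices s K" and C: "C \<in> conn_components S"
    and closed: "\<And>\<sigma>. \<sigma> \<in> simplices s K \<Longrightarrow> \<sigma> \<subseteq> vertices C \<Longrightarrow> \<sigma> \<in> S"
  shows "closed_simplices s K C"
  unfolding closed_simplices_def
proof (intro equalityI subsetI)
  fix \<sigma> assume "\<sigma> \<in> {\<sigma> \<in> simplices s K. \<sigma> \<subseteq> vertices C}"
  then have "\<sigma> \<in> S" "\<sigma> \<subseteq> vertices C" "\<sigma> \<noteq> {}"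
    using closed empty_notin_simplices by auto
  then show "\<sigma> \<in> C"
    using C by (intro conn_component_memI[of C S]) auto
next
  fix \<sigma> assume "\<sigma> \<in> C"
  then show "\<sigma> \<in> {\<sigma> \<in> simplices s K. \<sigma> \<subseteq> vertices C}"
    using S conn_component_subset[OF C] by (auto simp: vertices_def)
qed

definition monochrome_simplices :: "nat \<Rightarrow> 'a set set \<Rightarrow> ('a \<Rightarrow> nat) \<Rightarrow> 'a set set" where
  "monochrome_simplices s K f = {\<sigma> \<in> simplices s K. monochrome f \<sigma>}"

lemma monochrome_simplices_in_chromatic_lattice:
  "monochrome_simplices s K f \<in> chromatic_lattice s K"
proof -
  let ?M = "monochrome_simplices s K f"
  have M_subset: "?M \<subseteq> simplices s K" and M_monochrome: "\<forall>\<sigma>\<in>?M. monochrome f \<sigma>"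
    by (auto simp: monochrome_simplices_def)
  have "closed_simplices s K C" if C: "C \<in> conn_components ?M" for C
  proof (rule closed_simplices_conn_component[OF M_subset C])
    fix \<sigma> assume "\<sigma> \<in> simplices s K" "\<sigma> \<subseteq> vertices C"
    moreover have "monochrome f (vertices C)"
      using M_monochrome C by (rule monochrome_vertices_conn_component)
    ultimately show "\<sigma> \<in> ?M"
      by (simp add: monochrome_simplices_def monochrome_subset)
  qed
  with M_subset show ?thesis
    by (simp add: chromatic_lattice_def)
qed

lemma empty_in_chromatic_lattice: "{} \<in> chromatic_lattice s K"
  by (simp add: chromatic_lattice_def conn_components_def)

lemma finite_chromatic_lattice:
  assumes "finite K"
  shows "finite (chromatic_lattice s K)"
proof (rule finite_subset)
  show "chromatic_lattice s K \<subseteq> Pow K"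
    by (auto simp: chromatic_lattice_def simplices_def)
qed (use assms in simp)

lemma finite_vertices: "simplicial_complex K \<Longrightarrow> finite K \<Longrightarrow> finite (vertices K)"
  by (auto simp: vertices_def simplicial_complex_def)

lemma colorings_eq_no_monochrome_simplices:
  "colorings r s K = {f \<in> vertices K \<rightarrow>\<^sub>E {1..r}. monochrome_simplices s K f = {}}"
  by (auto simp: colorings_def monochrome_simplices_def)

lemma card_maps_subset_monochrome_simplices:
  assumes "finite (vertices K)" and T: "T \<subseteq> simplices s K"
  shows "card {f \<in> vertices K \<rightarrow>\<^sub>E {1..r}. T \<subseteq> monochrome_simplices s K f}
    = r ^ card (block_partition K T)"
proof -
  have "T \<subseteq> K" "{} \<notin> T"
    using T empty_notin_simplices by (auto simp: simplices_def)
  then have "partition_on (vertices K) (block_partition K T)"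
    by (rule partition_on_block_partition)
  moreover have "T \<subseteq> monochrome_simplices s K f
      \<longleftrightarrow> (\<forall>p\<in>block_partition K T. monochrome f p)" for f
    using T unfolding all_monochrome_iff_blocks_monochrome[symmetric] monochrome_simplices_def
    by blast
  ultimately show ?thesis
    using assms(1) by (simp add: card_PiE_monochrome_blocks)
qed

theorem theorem2p24:
  fixes K :: "'a set set" and s r :: nat
  assumes "simplicial_complex K" and "finite K" and "vertices K \<noteq> {}"
    and "s \<ge> 1" and "r \<ge> 1"
  shows "int (num_colorings s K r) =
    (\<Sum>T \<in> chromatic_lattice s K.
       mobius (chromatic_lattice s K) {} T * int r ^ card (block_partition K T))"
proof -
  let ?L = "chromatic_lattice s K" and ?F = "vertices K \<rightarrow>\<^sub>E {1..r}"
  let ?M = "monochrome_simplices s K"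
  have finite_V: "finite (vertices K)"
    using assms(1,2) by (rule finite_vertices)
  then have "finite ?F"
    by (simp add: finite_PiE)
  have "int (num_colorings s K r) = int (card {f \<in> ?F. ?M f = {}})"
    by (simp add: num_colorings_def colorings_eq_no_monochrome_simplices)
  also have "\<dots> = (\<Sum>T\<in>?L. mobius ?L {} T * int (card {f \<in> ?F. T \<subseteq> ?M f}))"
    using \<open>finite ?F\<close> finite_chromatic_lattice[OF assms(2)] monochrome_simplices_in_chromatic_lattice
      empty_in_chromatic_lattice by (intro card_fiber_eq_sum_mobius) auto
  also have "\<dots> = (\<Sum>T\<in>?L. mobius ?L {} T * int r ^ card (block_partition K T))"
    using card_maps_subset_monochrome_simplices[OF finite_V]
    by (intro sum.cong refl) (simp add: chromatic_lattice_def)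
  finally show ?thesis .
qed

end
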